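(* There exists a cubic (i.e. $3$-regular), $2$-ended, vertex-transitive graph which is not isomorphic to any Cayley graph.
   Context: A ray is a one-way infinite path; two rays are equivalent if no finite set of edges separates them; the equivalence classes are the ends, and $2$-ended means exactly two ends. Vertex-transitive means the automorphism group acts transitively on vertices. A Cayley graph of a group $\Gamma$ with respect to a generating set $S$ (closed under inverses, not containing the identity) has vertex set $\Gamma$ and edges $\{g,gs\}$ for $g\in\Gamma$, $s\in S$; equivalently (Sabidussi), a graph is isomorphic to a Cayley graph iff some subgroup of its automorphism group acts freely and transitively on its vertices. *)

theory Defs
  imports "HOL-Algebra.Generated_Groups"
begin

record 'a ugraph =
  vertices :: "'a set"
  edges :: "'a set set"

definition simple_graph :: "'a ugraph \<Rightarrow> bool" where
  "simple_graph G \<longleftrightarrow>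
     (\<forall>e\<in>edges G. \<exists>u\<in>vertices G. \<exists>v\<in>vertices G. u \<noteq> v \<and> e = {u, v})"

definition cubic_graph :: "'a ugraph \<Rightarrow> bool" where
  "cubic_graph G \<longleftrightarrow> (\<forall>v\<in>vertices G. card {e \<in> edges G. v \<in> e} = 3)"

definition linked :: "'a set set \<Rightarrow> 'a \<Rightarrow> 'a \<Rightarrow> bool" where
  "linked E u v \<longleftrightarrow> (u, v) \<in> {(x, y). {x, y} \<in> E}\<^sup>*"

text \<open>
  Cayley graphs are connected, since \<open>S\<close> generates the group. So a disconnected graph, such as two
  disjoint hexagonal lattices, would be a trivial two-ended cubic vertex-transitive non-Cayley graph.
\<close>
definition connected_graph :: "'a ugraph \<Rightarrow> bool" where
  "connected_graph G \<longleftrightarrow> (\<forall>u\<in>vertices G. \<forall>v\<in>vertices G. linked (edges G) u v)"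

definition graph_iso :: "('a \<Rightarrow> 'b) \<Rightarrow> 'a ugraph \<Rightarrow> 'b ugraph \<Rightarrow> bool" where
  "graph_iso f G H \<longleftrightarrow> bij_betw f (vertices G) (vertices H) \<and>
     (\<forall>u\<in>vertices G. \<forall>v\<in>vertices G. {u, v} \<in> edges G \<longleftrightarrow> {f u, f v} \<in> edges H)"

definition isomorphic_graphs :: "'a ugraph \<Rightarrow> 'b ugraph \<Rightarrow> bool" where
  "isomorphic_graphs G H \<longleftrightarrow> (\<exists>f. graph_iso f G H)"

definition vertex_transitive :: "'a ugraph \<Rightarrow> bool" where
  "vertex_transitive G \<longleftrightarrow>
     (\<forall>u\<in>vertices G. \<forall>v\<in>vertices G. \<exists>f. graph_iso f G G \<and> f u = v)"

definition rays :: "'a ugraph \<Rightarrow> (nat \<Rightarrow> 'a) set" where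
  "rays G = {r. inj r \<and> range r \<subseteq> vertices G \<and> (\<forall>n. {r n, r (Suc n)} \<in> edges G)}"

text \<open>
  As \<open>F\<close> is finite, each of the two rays has a tail that avoids \<open>F\<close> and so lies in a single
  component of \<open>G - F\<close>. Separation means that these two components are different.
\<close>
definition separates :: "'a ugraph \<Rightarrow> 'a set set \<Rightarrow> (nat \<Rightarrow> 'a) \<Rightarrow> (nat \<Rightarrow> 'a) \<Rightarrow> bool" where
  "separates G F r s \<longleftrightarrow> (\<exists>N. \<forall>m\<ge>N. \<forall>n\<ge>N. \<not> linked (edges G - F) (r m) (s n))"

definition ray_equiv :: "'a ugraph \<Rightarrow> ((nat \<Rightarrow> 'a) \<times> (nat \<Rightarrow> 'a)) set" where
  "ray_equiv G = {(r, s). r \<in> rays G \<and> s \<in> rays G \<and>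
     \<not> (\<exists>F\<subseteq>edges G. finite F \<and> separates G F r s)}"

definition ends :: "'a ugraph \<Rightarrow> (nat \<Rightarrow> 'a) set set" where
  "ends G = rays G // ray_equiv G"

definition two_ended :: "'a ugraph \<Rightarrow> bool" where
  "two_ended G \<longleftrightarrow> card (ends G) = 2"

definition cayley_generators :: "('g, 'm) monoid_scheme \<Rightarrow> 'g set \<Rightarrow> bool" where
  "cayley_generators \<Gamma> S \<longleftrightarrow> S \<subseteq> carrier \<Gamma> \<and> generate \<Gamma> S = carrier \<Gamma> \<and>
     (\<forall>s\<in>S. inv\<^bsub>\<Gamma>\<^esub> s \<in> S) \<and> \<one>\<^bsub>\<Gamma>\<^esub> \<notin> S"

definition cayley_graph :: "('g, 'm) monoid_scheme \<Rightarrow> 'g set \<Rightarrow> 'g ugraph" where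
  "cayley_graph \<Gamma> S = \<lparr>vertices = carrier \<Gamma>,
     edges = {{g, g \<otimes>\<^bsub>\<Gamma>\<^esub> s} | g s. g \<in> carrier \<Gamma> \<and> s \<in> S}\<rparr>"

text \<open>
  The group ranges over the vertex type of \<open>G\<close>. This loses no generality, by
  \<open>isomorphic_cayley_imp_is_cayley\<close> below.
\<close>
definition is_cayley :: "'a ugraph \<Rightarrow> bool" where
  "is_cayley G \<longleftrightarrow> (\<exists>(\<Gamma> :: 'a monoid) S. group \<Gamma> \<and> cayley_generators \<Gamma> S \<and>
     isomorphic_graphs G (cayley_graph \<Gamma> S))"

lemma linked_refl: "linked E u u"
  by (simp add: linked_def)

lemma linked_trans: "linked E u v \<Longrightarrow> linked E v w \<Longrightarrow> linked E u w"
  unfolding linked_def by (rule rtrancl_trans)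

lemma linked_sym: "linked E u v \<Longrightarrow> linked E v u"
proof -
  have "sym {(x, y). {x, y} \<in> E}" by (auto simp: sym_def insert_commute)
  then show "linked E u v \<Longrightarrow> linked E v u"
    unfolding linked_def by (meson sym_rtrancl symD)
qed

lemma ray_tail_linked:
  assumes r: "r \<in> rays G" and F: "finite F"
  obtains N where "\<And>m n. m \<ge> N \<Longrightarrow> n \<ge> N \<Longrightarrow> linked (edges G - F) (r m) (r n)"
proof -
  let ?e = "\<lambda>n. {r n, r (Suc n)}"
  have "inj r" using r by (simp add: rays_def)
  then have eq: "r m = r n \<longleftrightarrow> m = n" for m n by (rule inj_eq)
  have "inj ?e" by (rule injI) (auto simp: doubleton_eq_iff eq)
  then have "finite (?e -` F)" using F by (simp add: finite_vimageI)
  then obtain N where "\<forall>n\<in>?e -` F. n < N"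
    using finite_nat_set_iff_bounded by blast
  then have "?e n \<notin> F" if "n \<ge> N" for n
    using that by (meson linorder_not_le vimageI2)
  moreover have "?e n \<in> edges G" for n
    using r by (simp add: rays_def)
  ultimately have N: "?e n \<in> edges G - F" if "n \<ge> N" for n
    using that by blast
  have up: "linked (edges G - F) (r N) (r n)" if "n \<ge> N" for n
    using that
  proof (induction n rule: dec_induct)
    case base then show ?case by (rule linked_refl)
  next
    case (step n)
    have "linked (edges G - F) (r n) (r (Suc n))"
      unfolding linked_def using N[OF step.hyps(1)] by (intro r_into_rtrancl) simp
    with step.IH show ?case by (rule linked_trans)
  qed
  show ?thesis
    by (rule that[of N]) (rule linked_trans[OF linked_sym[OF up] up])
qed

lemma equiv_ray_equiv: "equiv (rays G) (ray_equiv G)"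
proof (rule equivI)
  show "ray_equiv G \<subseteq> rays G \<times> rays G" by (auto simp: ray_equiv_def)
  show "refl_on (rays G) (ray_equiv G)"
    by (auto simp: refl_on_def ray_equiv_def separates_def intro: linked_refl)
  show "sym (ray_equiv G)"
    unfolding sym_def ray_equiv_def separates_def by (auto; meson linked_sym)
  show "trans (ray_equiv G)"
  proof (rule transI)
    fix r s t assume rs: "(r, s) \<in> ray_equiv G" and st: "(s, t) \<in> ray_equiv G"
    have "\<not> separates G F r t" if F: "F \<subseteq> edges G" "finite F" for F
      unfolding separates_def
    proof (clarify)
      fix N assume sep: "\<forall>m\<ge>N. \<forall>n\<ge>N. \<not> linked (edges G - F) (r m) (t n)"
      have "s \<in> rays G" using rs by (simp add: ray_equiv_def)
      then obtain K where K: "\<And>m n. m \<ge> K \<Longrightarrow> n \<ge> K \<Longrightarrow> linked (edges G - F) (s m) (s n)"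
        using ray_tail_linked F(2) by metis
      let ?M = "max N K"
      have "\<not> separates G F r s" "\<not> separates G F s t"
        using rs st F by (auto simp: ray_equiv_def)
      then obtain a b c d where "a \<ge> ?M" "b \<ge> ?M" "c \<ge> ?M" "d \<ge> ?M"
        "linked (edges G - F) (r a) (s b)" "linked (edges G - F) (s c) (t d)"
        unfolding separates_def by meson
      with K sep show False by (metis linked_trans max.bounded_iff)
    qed
    with rs st show "(r, t) \<in> ray_equiv G" by (auto simp: ray_equiv_def)
  qed
qed

lemma isomorphic_cayley_imp_is_cayley:
  fixes G :: "'a ugraph" and \<Gamma> :: "('g, 'm) monoid_scheme"
  assumes grp: "group \<Gamma>" and S: "cayley_generators \<Gamma> S"
    and iso: "isomorphic_graphs G (cayley_graph \<Gamma> S)"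
  shows "is_cayley G"
proof -
  interpret group \<Gamma> by (rule grp)
  obtain f where f: "graph_iso f G (cayley_graph \<Gamma> S)"
    using iso by (auto simp: isomorphic_graphs_def)
  have bf: "bij_betw f (vertices G) (carrier \<Gamma>)"
    using f by (simp add: graph_iso_def cayley_graph_def)
  define h where "h = inv_into (vertices G) f"
  have bh: "bij_betw h (carrier \<Gamma>) (vertices G)"
    unfolding h_def by (rule bij_betw_inv_into[OF bf])
  have fh: "f (h x) = x" if "x \<in> carrier \<Gamma>" for x
    unfolding h_def by (rule bij_betw_inv_into_right[OF bf that])
  have hf: "h (f x) = x" if "x \<in> vertices G" for x
    unfolding h_def by (rule bij_betw_inv_into_left[OF bf that])
  have hv: "h x \<in> vertices G" if "x \<in> carrier \<Gamma>" for x
    using bh that by (rule bij_betwE[THEN bspec])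
  have fv: "f x \<in> carrier \<Gamma>" if "x \<in> vertices G" for x
    using bf that by (rule bij_betwE[THEN bspec])
  define \<Delta> :: "'a monoid" where
    "\<Delta> = \<lparr>carrier = vertices G, monoid.mult = (\<lambda>x y. h (f x \<otimes>\<^bsub>\<Gamma>\<^esub> f y)), one = h \<one>\<^bsub>\<Gamma>\<^esub>\<rparr>"
  have hiso: "h \<in> iso \<Gamma> \<Delta>"
    using bh by (auto simp: iso_def hom_def \<Delta>_def fh hv)
  have "group (\<Delta>\<lparr>one := h \<one>\<^bsub>\<Gamma>\<^esub>\<rparr>)" by (rule iso_imp_img_group[OF hiso])
  then have D: "group \<Delta>" by (simp add: \<Delta>_def)
  have hom: "group_hom \<Gamma> \<Delta> h"
    using D grp hiso by (simp add: group_hom_def group_hom_axioms_def iso_def)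
  have Sc: "S \<subseteq> carrier \<Gamma>" using S by (simp add: cayley_generators_def)
  have injh: "inj_on h (carrier \<Gamma>)" using bh by (simp add: bij_betw_def)
  have "cayley_generators \<Delta> (h ` S)"
    unfolding cayley_generators_def
  proof (intro conjI ballI)
    show "h ` S \<subseteq> carrier \<Delta>" using Sc hv by (auto simp: \<Delta>_def)
    show "generate \<Delta> (h ` S) = carrier \<Delta>"
      using group_hom.generate_img[OF hom Sc] S bh
      by (simp add: cayley_generators_def \<Delta>_def bij_betw_def)
    show "inv\<^bsub>\<Delta>\<^esub> s \<in> h ` S" if "s \<in> h ` S" for s
    proof -
      from that obtain t where t: "t \<in> S" "s = h t" by blast
      have "inv\<^bsub>\<Delta>\<^esub> s = h (inv\<^bsub>\<Gamma>\<^esub> t)"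
        using group_hom.hom_inv[OF hom, of t] t Sc by auto
      then show ?thesis using t S by (simp add: cayley_generators_def)
    qed
    show "\<one>\<^bsub>\<Delta>\<^esub> \<notin> h ` S"
    proof
      assume "\<one>\<^bsub>\<Delta>\<^esub> \<in> h ` S"
      then obtain t where t: "t \<in> S" "h \<one>\<^bsub>\<Gamma>\<^esub> = h t" by (auto simp: \<Delta>_def)
      then have "\<one>\<^bsub>\<Gamma>\<^esub> = t" using inj_onD[OF injh t(2)] Sc by blast
      then show False using t S by (simp add: cayley_generators_def)
    qed
  qed
  moreover have "graph_iso id G (cayley_graph \<Delta> (h ` S))"
  proof -
    have "edges (cayley_graph \<Delta> (h ` S)) = (`) h ` edges (cayley_graph \<Gamma> S)" (is "?L = ?R")
    proof
      show "?L \<subseteq> ?R"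
      proof
        fix e assume "e \<in> ?L"
        then obtain x s where x: "x \<in> vertices G" "s \<in> S" and e: "e = {x, h (f x \<otimes>\<^bsub>\<Gamma>\<^esub> f (h s))}"
          by (auto simp: cayley_graph_def \<Delta>_def)
        have "e = h ` {f x, f x \<otimes>\<^bsub>\<Gamma>\<^esub> s}" using x e Sc by (simp add: hf fh subsetD)
        moreover have "{f x, f x \<otimes>\<^bsub>\<Gamma>\<^esub> s} \<in> edges (cayley_graph \<Gamma> S)"
          using x fv by (auto simp: cayley_graph_def)
        ultimately show "e \<in> ?R" by blast
      qed
      show "?R \<subseteq> ?L"
      proof
        fix e assume "e \<in> ?R"
        then obtain g s where g: "g \<in> carrier \<Gamma>" "s \<in> S" and e: "e = {h g, h (g \<otimes>\<^bsub>\<Gamma>\<^esub> s)}"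
          by (auto simp: cayley_graph_def)
        have "e = {h g, h g \<otimes>\<^bsub>\<Delta>\<^esub> h s}" using g e Sc by (simp add: \<Delta>_def fh subsetD)
        moreover have "h g \<in> carrier \<Delta>" using g hv by (simp add: \<Delta>_def)
        ultimately show "e \<in> ?L" using g by (auto simp: cayley_graph_def)
      qed
    qed
    moreover have "{u, v} \<in> (`) h ` edges (cayley_graph \<Gamma> S) \<longleftrightarrow>
        {f u, f v} \<in> edges (cayley_graph \<Gamma> S)" if "u \<in> vertices G" "v \<in> vertices G" for u v
    proof
      assume "{u, v} \<in> (`) h ` edges (cayley_graph \<Gamma> S)"
      then obtain e where e: "e \<in> edges (cayley_graph \<Gamma> S)" "{u, v} = h ` e" by blast
      have "e \<subseteq> carrier \<Gamma>" using e(1) Sc by (auto simp: cayley_graph_def)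
      then have "f ` h ` e = id ` e" unfolding image_image by (intro image_cong) (auto simp: fh)
      then have "f ` h ` e = e" by simp
      then have "{f u, f v} = e" unfolding e(2)[symmetric] by simp
      then show "{f u, f v} \<in> edges (cayley_graph \<Gamma> S)" using e(1) by simp
    next
      assume a: "{f u, f v} \<in> edges (cayley_graph \<Gamma> S)"
      have "{u, v} = h ` {f u, f v}" using that by (simp add: hf)
      then show "{u, v} \<in> (`) h ` edges (cayley_graph \<Gamma> S)" using a by blast
    qed
    moreover have "vertices (cayley_graph \<Delta> (h ` S)) = vertices G"
      by (simp add: cayley_graph_def \<Delta>_def)
    ultimately show ?thesis using f by (simp add: graph_iso_def)
  qed
  ultimately show ?thesis
    unfolding is_cayley_def isomorphic_graphs_def using D by blast
qed

end

theory Submission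
  imports Defs "HOL-Library.Nat_Bijection"
begin

text \<open>
  The graph is a two-way infinite chain of 10-cycles. Every second vertex of a 10-cycle is matched to
  a vertex of the previous 10-cycle and the others to vertices of the next one, in such a way that
  the cyclic order of the five matched vertices in one 10-cycle (a pentagon) becomes the pentagram
  in the next. The edges of the matching can be told apart from the others by the 8-cycles through
  them, so every automorphism preserves the matching. In a regular group of automorphisms, the
  element that moves a vertex to its partner therefore swaps the two, and is an involution by
  regularity. It induces an involution of five points that exchanges the pentagon with the pentagram.
  There is none: multiplication by 2 modulo 5 exchanges them, and all such permutations have order 4.
\<close>

section \<open>Graphs layered by the integers\<close>

lemma linked_map:
  assumes "linked E u v" and "\<And>x y. {x, y} \<in> E \<Longrightarrow> {f x, f y} \<in> E'"
  shows "linked E' (f u) (f v)"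
  using assms(1) unfolding linked_def
proof (induction rule: rtrancl_induct)
  case (step y z)
  then have "(f y, f z) \<in> {(x, y). {x, y} \<in> E'}" using assms(2) by auto
  then show ?case using step.IH by (rule rtrancl.rtrancl_into_rtrancl[rotated])
qed simp

lemma linked_mono: "linked E u v \<Longrightarrow> E \<subseteq> E' \<Longrightarrow> linked E' u v"
  using linked_map[of E u v "\<lambda>x. x" E'] by auto

lemma linked_edge: "{u, v} \<in> E \<Longrightarrow> linked E u v"
  by (auto simp: linked_def)

text \<open>The last two assumptions look upward only. Both ends are reached by instantiating the
  locale with a level function and with its negative.\<close>

locale layered_graph =
  fixes G :: "'a ugraph" and lev :: "'a \<Rightarrow> int"
  assumes simple: "simple_graph G"
    and nonempty: "vertices G \<noteq> {}"
    and lev_edge: "{u, v} \<in> edges G \<Longrightarrow> \<bar>lev u - lev v\<bar> = 1"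
    and finite_level: "finite {v \<in> vertices G. lev v = i}"
    and ascend: "v \<in> vertices G \<Longrightarrow> \<exists>w. {v, w} \<in> edges G \<and> lev w = lev v + 1"
    and linked_above: "u \<in> vertices G \<Longrightarrow> v \<in> vertices G \<Longrightarrow> k \<le> lev u \<Longrightarrow> k \<le> lev v \<Longrightarrow>
      linked {e \<in> edges G. \<forall>w\<in>e. k \<le> lev w} u v"
begin

lemma edge_vertices: "{u, v} \<in> edges G \<Longrightarrow> u \<in> vertices G \<and> v \<in> vertices G"
  using simple unfolding simple_graph_def by (metis doubleton_eq_iff)

text \<open>The threshold 0 is arbitrary: by \<open>ascending_unbounded\<close> such a ray finally
  stays above any given level.\<close>

definition ascending :: "(nat \<Rightarrow> 'a) \<Rightarrow> bool" where
  "ascending r \<longleftrightarrow> (\<exists>N. \<forall>n\<ge>N. lev (r n) > 0)"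

lemma finite_window: "finite {v \<in> vertices G. a \<le> lev v \<and> lev v \<le> b}"
proof -
  have "{v \<in> vertices G. a \<le> lev v \<and> lev v \<le> b} = (\<Union>i\<in>{a..b}. {v \<in> vertices G. lev v = i})"
    by auto
  then show ?thesis using finite_level by simp
qed

lemma ray_leaves_finite:
  assumes "r \<in> rays G" and "finite A"
  obtains N where "\<And>n. n \<ge> N \<Longrightarrow> r n \<notin> A"
proof -
  have "finite (r -` A)" using assms by (simp add: rays_def finite_vimageI)
  then obtain N where "\<forall>n\<in>r -` A. n < N" using finite_nat_set_iff_bounded by blast
  then show ?thesis by (intro that[of N]) (auto simp: not_le[symmetric])
qed

lemma ray_lev: "r \<in> rays G \<Longrightarrow> \<bar>lev (r n) - lev (r (Suc n))\<bar> = 1"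
  by (rule lev_edge) (simp add: rays_def)

text \<open>Being injective, a ray visits the finite level \<open>k\<close> only finitely often. Its
  level changes by 1 at each step, so after that it cannot cross \<open>k\<close>.\<close>

lemma ray_dichotomy:
  assumes r: "r \<in> rays G"
  obtains N where "\<forall>n\<ge>N. lev (r n) > k" | N where "\<forall>n\<ge>N. lev (r n) < k"
proof -
  obtain N where N: "\<And>n. n \<ge> N \<Longrightarrow> r n \<notin> {v \<in> vertices G. lev v = k}"
    using ray_leaves_finite[OF r finite_level] by blast
  then have ne: "lev (r n) \<noteq> k" if "n \<ge> N" for n
    using r that by (auto simp: rays_def)
  show ?thesis
  proof (cases "lev (r N) > k")
    case True
    have "lev (r n) > k" if "n \<ge> N" for n
      using that
    proof (induction n rule: dec_induct)
      case (step n)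
      then show ?case using ne[of "Suc n"] ray_lev[OF r, of n] by linarith
    qed (rule True)
    then show ?thesis using that(1) by blast
  next
    case False
    have "lev (r n) < k" if "n \<ge> N" for n
      using that
    proof (induction n rule: dec_induct)
      case base then show ?case using False ne[of N] by linarith
    next
      case (step n)
      then show ?case using ne[of "Suc n"] ray_lev[OF r, of n] by linarith
    qed
    then show ?thesis using that(2) by blast
  qed
qed

lemma ascending_unbounded:
  assumes r: "r \<in> rays G" and a: "ascending r"
  obtains N where "\<forall>n\<ge>N. lev (r n) > k"
proof -
  obtain M where M: "\<forall>n\<ge>M. lev (r n) > 0" using a by (auto simp: ascending_def)
  obtain L where L: "\<And>n. n \<ge> L \<Longrightarrow> r n \<notin> {v \<in> vertices G. 0 \<le> lev v \<and> lev v \<le> k}"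
    using ray_leaves_finite[OF r finite_window] by blast
  have "lev (r n) > k" if "n \<ge> max L M" for n
    using L[of n] M that r by (force simp: rays_def)
  then show ?thesis using that by blast
qed

text \<open>A finite \<open>F\<close> lies below some level \<open>k\<close>. The part from
  \<open>k\<close> upward is linked without \<open>F\<close> and contains a tail of each
  ray.\<close>

lemma ascending_equiv:
  assumes r: "r \<in> rays G" "ascending r" and s: "s \<in> rays G" "ascending s"
  shows "(r, s) \<in> ray_equiv G"
proof -
  have "\<not> separates G F r s" if F: "F \<subseteq> edges G" "finite F" for F
    unfolding separates_def
  proof clarify
    fix N assume sep: "\<forall>m\<ge>N. \<forall>n\<ge>N. \<not> linked (edges G - F) (r m) (s n)"
    have "finite e" if "e \<in> F" for e
      using that F(1) simple by (auto simp: simple_graph_def)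
    then have fin: "finite (lev ` \<Union>F)" using F(2) by auto
    \<comment> \<open>\<open>insert 0\<close> keeps \<open>Max\<close> meaningful for empty
      \<open>F\<close>.\<close>
    define k where "k = Max (insert 0 (lev ` \<Union>F)) + 1"
    have k: "lev v < k" if "v \<in> e" "e \<in> F" for v e
    proof -
      have "lev v \<le> Max (insert 0 (lev ` \<Union>F))"
        using that fin by (intro Max_ge) auto
      then show ?thesis by (simp add: k_def)
    qed
    obtain A where A: "\<forall>n\<ge>A. lev (r n) > k" using ascending_unbounded[OF r] by blast
    obtain B where B: "\<forall>n\<ge>B. lev (s n) > k" using ascending_unbounded[OF s] by blast
    have "linked {e \<in> edges G. \<forall>w\<in>e. k \<le> lev w} (r (max N A)) (s (max N B))"
      using r s A B by (intro linked_above) (auto simp: rays_def less_imp_le)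
    moreover have "{e \<in> edges G. \<forall>w\<in>e. k \<le> lev w} \<subseteq> edges G - F"
    proof
      fix e assume e: "e \<in> {e \<in> edges G. \<forall>w\<in>e. k \<le> lev w}"
      \<comment> \<open>An edge has an endpoint, so lying above \<open>k\<close> is not vacuous and
        rules out membership in \<open>F\<close>.\<close>
      then obtain u where "u \<in> e" using simple by (fastforce simp: simple_graph_def)
      with e k show "e \<in> edges G - F" by force
    qed
    ultimately have "linked (edges G - F) (r (max N A)) (s (max N B))" by (rule linked_mono)
    then show False using sep by simp
  qed
  then show ?thesis using r s by (auto simp: ray_equiv_def)
qed

lemma ascending_ray: obtains r where "r \<in> rays G" "ascending r"
proof -
  obtain v0 where v0: "v0 \<in> vertices G" using nonempty by blast
  obtain g where g: "\<And>v. v \<in> vertices G \<Longrightarrow> {v, g v} \<in> edges G \<and> lev (g v) = lev v + 1"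
    using ascend by metis
  define r where "r n = (g ^^ n) v0" for n
  have V: "r n \<in> vertices G" for n
    by (induction n) (auto simp: r_def v0 dest: g edge_vertices)
  have lev: "lev (r n) = lev v0 + int n" for n
  proof (induction n)
    case (Suc n)
    then show ?case using g[OF V[of n]] by (simp add: r_def)
  qed (simp add: r_def)
  have "inj r" by (rule injI) (metis lev add_left_cancel of_nat_eq_iff)
  moreover have "{r n, r (Suc n)} \<in> edges G" for n
    using g[OF V[of n]] by (simp add: r_def)
  ultimately have "r \<in> rays G" using V by (auto simp: rays_def)
  moreover have "ascending r" unfolding ascending_def
    by (rule exI[of _ "nat (1 - lev v0)"]) (auto simp: lev)
  ultimately show ?thesis by (rule that)
qed

text \<open>Adjacent levels differ by 1, so the edges between levels 0 and 1 form a finite cut that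
  separates the positive levels from the rest.\<close>

lemma ascending_not_equiv:
  assumes r: "r \<in> rays G" "ascending r" and s: "s \<in> rays G" "\<forall>n\<ge>N. lev (s n) < 0"
  shows "(r, s) \<notin> ray_equiv G"
proof -
  define W where "W = {v \<in> vertices G. 0 \<le> lev v \<and> lev v \<le> 1}"
  define F where "F = edges G \<inter> Pow W"
  have "finite F" using finite_window by (simp add: F_def W_def)
  moreover have "separates G F r s"
  proof -
    obtain M where M: "\<forall>n\<ge>M. lev (r n) > 0" using r by (auto simp: ascending_def)
    have up: "lev v > 0" if "linked (edges G - F) u v" "lev u > 0" for u v
      using that unfolding linked_def
    proof (induction rule: rtrancl_induct)
      case (step y z)
      then have e: "{y, z} \<in> edges G" "{y, z} \<notin> F" and y: "lev y > 0" by auto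
      show ?case
      proof (rule ccontr)
        assume "\<not> lev z > 0"
        then have "lev y = 1" "lev z = 0" using y lev_edge[OF e(1)] by linarith+
        then have "{y, z} \<in> F" using e(1) edge_vertices[OF e(1)] by (simp add: F_def W_def)
        then show False using e(2) by simp
      qed
    qed
    have "\<not> linked (edges G - F) (r m) (s n)" if "m \<ge> max M N" "n \<ge> max M N" for m n
    proof
      assume "linked (edges G - F) (r m) (s n)"
      then have "lev (s n) > 0" using up M that by auto
      moreover have "lev (s n) < 0" using s that by auto
      ultimately show False by simp
    qed
    then show ?thesis unfolding separates_def by blast
  qed
  ultimately show ?thesis by (auto simp: ray_equiv_def F_def)
qed

end

text \<open>By \<open>ray_dichotomy\<close> at level 0 every ray ascends for \<open>lev\<close> or
  for \<open>- lev\<close>. Each kind forms a single class, and the two classes differ by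
  \<open>ascending_not_equiv\<close>.\<close>

lemma two_ended_layered:
  assumes "layered_graph G lev" and "layered_graph G (\<lambda>v. - lev v)"
  shows "two_ended G"
proof -
  interpret up: layered_graph G lev by (rule assms)
  interpret down: layered_graph G "\<lambda>v. - lev v" by (rule assms)
  obtain r where r: "r \<in> rays G" "up.ascending r" by (rule up.ascending_ray)
  obtain s where s: "s \<in> rays G" "down.ascending s" by (rule down.ascending_ray)
  have eq: "equiv (rays G) (ray_equiv G)" by (rule equiv_ray_equiv)
  have either: "up.ascending t \<or> down.ascending t" if "t \<in> rays G" for t
    using up.ray_dichotomy[OF that, of 0]
    by (metis up.ascending_def down.ascending_def neg_0_less_iff_less)
  have "ends G = {ray_equiv G `` {r}, ray_equiv G `` {s}}"
  proof
    show "ends G \<subseteq> {ray_equiv G `` {r}, ray_equiv G `` {s}}"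
      unfolding ends_def
    proof
      fix e assume "e \<in> rays G // ray_equiv G"
      then obtain t where t: "t \<in> rays G" "e = ray_equiv G `` {t}" by (auto elim: quotientE)
      then have "(t, r) \<in> ray_equiv G \<or> (t, s) \<in> ray_equiv G"
        using either up.ascending_equiv[OF _ _ r] down.ascending_equiv[OF _ _ s] by blast
      then show "e \<in> {ray_equiv G `` {r}, ray_equiv G `` {s}}"
        using t equiv_class_eq[OF eq] by auto
    qed
    show "{ray_equiv G `` {r}, ray_equiv G `` {s}} \<subseteq> ends G"
      using r s by (auto simp: ends_def quotientI)
  qed
  moreover obtain N where "\<forall>n\<ge>N. lev (s n) < 0" using s by (auto simp: down.ascending_def)
  then have "(r, s) \<notin> ray_equiv G" using up.ascending_not_equiv[OF r s(1)] by blast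
  then have "ray_equiv G `` {r} \<noteq> ray_equiv G `` {s}"
    using eq_equiv_class[OF _ eq s(1)] by blast
  ultimately show ?thesis by (simp add: two_ended_def)
qed

section \<open>Regular actions on Cayley graphs\<close>

text \<open>Left translations preserve the quotient of two group elements that decides adjacency.
  The last conclusion is where freeness enters: a translation whose square fixes one vertex is an
  involution or the identity.\<close>

lemma cayley_regular_automorphism:
  assumes "is_cayley G" and u: "u \<in> vertices G" and v: "v \<in> vertices G"
  obtains r where "graph_iso r G G" and "r u = v"
    and "\<And>w. w \<in> vertices G \<Longrightarrow> r (r u) = u \<Longrightarrow> r (r w) = w"
proof -
  obtain \<Gamma> :: "'a monoid" and S f where "group \<Gamma>" and S: "cayley_generators \<Gamma> S"
    and f: "graph_iso f G (cayley_graph \<Gamma> S)"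
    using assms(1) unfolding is_cayley_def isomorphic_graphs_def by blast
  interpret group \<Gamma> by fact
  have Sc: "s \<in> S \<Longrightarrow> s \<in> carrier \<Gamma>" for s using S by (auto simp: cayley_generators_def)
  have bf: "bij_betw f (vertices G) (carrier \<Gamma>)"
    using f by (simp add: graph_iso_def cayley_graph_def)
  have fc [simp]: "w \<in> vertices G \<Longrightarrow> f w \<in> carrier \<Gamma>" for w using bf by (auto dest: bij_betwE)
  define h where "h = inv_into (vertices G) f"
  have bh: "bij_betw h (carrier \<Gamma>) (vertices G)"
    unfolding h_def by (rule bij_betw_inv_into[OF bf])
  have hv [simp]: "x \<in> carrier \<Gamma> \<Longrightarrow> h x \<in> vertices G" for x using bh by (auto dest: bij_betwE)
  have fh [simp]: "x \<in> carrier \<Gamma> \<Longrightarrow> f (h x) = x" for x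
    unfolding h_def by (rule bij_betw_inv_into_right[OF bf])
  have hf [simp]: "w \<in> vertices G \<Longrightarrow> h (f w) = w" for w
    unfolding h_def by (rule bij_betw_inv_into_left[OF bf])
  have edge: "{p, q} \<in> edges (cayley_graph \<Gamma> S) \<longleftrightarrow> inv\<^bsub>\<Gamma>\<^esub> p \<otimes>\<^bsub>\<Gamma>\<^esub> q \<in> S"
    if "p \<in> carrier \<Gamma>" "q \<in> carrier \<Gamma>" for p q
  proof
    assume "{p, q} \<in> edges (cayley_graph \<Gamma> S)"
    then obtain g s where g: "g \<in> carrier \<Gamma>" "s \<in> S" "{p, q} = {g, g \<otimes>\<^bsub>\<Gamma>\<^esub> s}"
      by (auto simp: cayley_graph_def)
    \<comment> \<open>An edge is unordered, so the quotient is either the generator or its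
      inverse.\<close>
    then have "inv\<^bsub>\<Gamma>\<^esub> p \<otimes>\<^bsub>\<Gamma>\<^esub> q = s \<or> inv\<^bsub>\<Gamma>\<^esub> p \<otimes>\<^bsub>\<Gamma>\<^esub> q = inv\<^bsub>\<Gamma>\<^esub> s"
      using Sc by (auto simp: doubleton_eq_iff inv_mult_group m_assoc) (simp_all add: m_assoc[symmetric])
    then show "inv\<^bsub>\<Gamma>\<^esub> p \<otimes>\<^bsub>\<Gamma>\<^esub> q \<in> S" using g S by (auto simp: cayley_generators_def)
  next
    assume a: "inv\<^bsub>\<Gamma>\<^esub> p \<otimes>\<^bsub>\<Gamma>\<^esub> q \<in> S"
    have "q = p \<otimes>\<^bsub>\<Gamma>\<^esub> (inv\<^bsub>\<Gamma>\<^esub> p \<otimes>\<^bsub>\<Gamma>\<^esub> q)" using that by (simp add: m_assoc[symmetric])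
    then have "{p, q} = {p, p \<otimes>\<^bsub>\<Gamma>\<^esub> (inv\<^bsub>\<Gamma>\<^esub> p \<otimes>\<^bsub>\<Gamma>\<^esub> q)}" by simp
    with a that show "{p, q} \<in> edges (cayley_graph \<Gamma> S)"
      unfolding cayley_graph_def by simp blast
  qed
  define c where "c = f v \<otimes>\<^bsub>\<Gamma>\<^esub> inv\<^bsub>\<Gamma>\<^esub> (f u)"
  have c [simp]: "c \<in> carrier \<Gamma>" using u v by (simp add: c_def)
  define r where "r w = h (c \<otimes>\<^bsub>\<Gamma>\<^esub> f w)" for w
  have bc: "bij_betw (\<lambda>x. c \<otimes>\<^bsub>\<Gamma>\<^esub> x) (carrier \<Gamma>) (carrier \<Gamma>)"
    by (rule bij_betw_byWitness[where f' = "\<lambda>x. inv\<^bsub>\<Gamma>\<^esub> c \<otimes>\<^bsub>\<Gamma>\<^esub> x"])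
      (auto simp: m_assoc[symmetric])
  have "bij_betw r (vertices G) (vertices G)"
    using bij_betw_trans[OF bij_betw_trans[OF bf bc] bh] by (simp add: r_def[abs_def] comp_def)
  moreover have "{r a, r b} \<in> edges G \<longleftrightarrow> {a, b} \<in> edges G"
    if ab: "a \<in> vertices G" "b \<in> vertices G" for a b
  proof -
    have "{r a, r b} \<in> edges G \<longleftrightarrow> inv\<^bsub>\<Gamma>\<^esub> (c \<otimes>\<^bsub>\<Gamma>\<^esub> f a) \<otimes>\<^bsub>\<Gamma>\<^esub> (c \<otimes>\<^bsub>\<Gamma>\<^esub> f b) \<in> S"
      using f ab by (simp add: graph_iso_def r_def edge)
    also have "inv\<^bsub>\<Gamma>\<^esub> (c \<otimes>\<^bsub>\<Gamma>\<^esub> f a) \<otimes>\<^bsub>\<Gamma>\<^esub> (c \<otimes>\<^bsub>\<Gamma>\<^esub> f b) = inv\<^bsub>\<Gamma>\<^esub> (f a) \<otimes>\<^bsub>\<Gamma>\<^esub> f b"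
      using ab by (simp add: inv_mult_group m_assoc) (simp add: m_assoc[symmetric])
    finally show ?thesis using f ab by (simp add: graph_iso_def edge)
  qed
  ultimately have "graph_iso r G G" by (simp add: graph_iso_def)
  moreover have "r u = v" using u v by (simp add: r_def c_def m_assoc)
  moreover have "r (r w) = w" if w: "w \<in> vertices G" and ru: "r (r u) = u" for w
  proof -
    have "f (r (r u)) = f u" using ru by simp
    \<comment> \<open>Cancelling \<open>f u\<close> leaves a relation for \<open>c\<close> alone,
      which then applies at every vertex.\<close>
    then have "c \<otimes>\<^bsub>\<Gamma>\<^esub> c = \<one>\<^bsub>\<Gamma>\<^esub>" using u
      by (simp add: r_def m_assoc[symmetric])
    then show ?thesis using w by (simp add: r_def m_assoc[symmetric])
  qed
  ultimately show ?thesis by (rule that)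
qed

section \<open>Decagons joined along pentagons and pentagrams\<close>

text \<open>The argument \<open>x\<close> of \<open>vtx i x\<close> only matters modulo 5.\<close>

definition vtx :: "int \<Rightarrow> int \<Rightarrow> nat" where
  "vtx i x = 5 * int_encode i + nat (x mod 5)"

text \<open>\<open>lev\<close> and \<open>pos\<close> invert \<open>vtx\<close>: each natural number
  encodes exactly one pair of a level and a residue.\<close>

definition lev :: "nat \<Rightarrow> int" where
  "lev n = int_decode (n div 5)"

definition pos :: "nat \<Rightarrow> int" where
  "pos n = int (n mod 5)"

text \<open>
  Levels \<open>2j\<close> and \<open>2j + 1\<close> form a 10-cycle, and levels \<open>2j + 1\<close> and \<open>2j + 2\<close> are matched by equal
  residues. The alternation between \<open>\<pm>1\<close> and \<open>\<pm>2\<close> turns pentagons into pentagrams.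
\<close>

definition steps :: "int \<Rightarrow> int set" where
  "steps i = (if odd i then {0} else if 4 dvd i then {1, -1} else {2, -2})"

definition rises :: "nat \<Rightarrow> nat \<Rightarrow> bool" where
  "rises u v \<longleftrightarrow> (\<exists>i x c. c \<in> steps i \<and> u = vtx i x \<and> v = vtx (i + 1) (x + c))"

definition adj :: "nat \<Rightarrow> nat \<Rightarrow> bool" where
  "adj u v \<longleftrightarrow> rises u v \<or> rises v u"

definition decagon_graph :: "nat ugraph" where
  "decagon_graph = \<lparr>vertices = UNIV, edges = {{u, v} | u v. adj u v}\<rparr>"

definition mate :: "nat \<Rightarrow> nat" where
  "mate n = vtx (if odd (lev n) then lev n + 1 else lev n - 1) (pos n)"

section \<open>Coordinates and neighbourhoods\<close>

lemma lev_vtx [simp]: "lev (vtx i x) = i"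
proof -
  have "(5 * int_encode i + nat (x mod 5)) div 5 = int_encode i"
    by (simp add: nat_less_iff)
  then show ?thesis by (simp add: lev_def vtx_def)
qed

lemma pos_vtx [simp]: "pos (vtx i x) = x mod 5"
  by (simp add: pos_def vtx_def nat_less_iff)

lemma vtx_lev_pos [simp]: "vtx (lev n) (pos n) = n"
  by (simp add: vtx_def lev_def pos_def flip: zmod_int)

lemma vtx_eq_iff: "vtx i x = vtx j y \<longleftrightarrow> i = j \<and> x mod 5 = y mod 5"
proof
  assume "vtx i x = vtx j y"
  then show "i = j \<and> x mod 5 = y mod 5" by (metis lev_vtx pos_vtx)
qed (simp add: vtx_def)

lemma vtx_cases: obtains i x where "n = vtx i x"
  by (metis vtx_lev_pos)

lemma adj_sym: "adj u v \<longleftrightarrow> adj v u"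
  by (auto simp: adj_def)

text \<open>By this symmetry the same form of displacement describes neighbours below and above, as
  in \<open>adj_vtx\<close>.\<close>

lemma steps_uminus: "- c \<in> steps i \<longleftrightarrow> c \<in> steps i"
  by (auto simp: steps_def)

lemma steps_nonempty: "steps i \<noteq> {}"
  by (simp add: steps_def)

lemma rises_vtx: "rises (vtx i x) w \<longleftrightarrow> (\<exists>c\<in>steps i. w = vtx (i + 1) (x + c))"
proof
  assume "rises (vtx i x) w"
  then obtain y c where c: "c \<in> steps i" "w = vtx (i + 1) (y + c)" "x mod 5 = y mod 5"
    by (auto simp: rises_def vtx_eq_iff)
  then have "w = vtx (i + 1) (x + c)" by (simp add: vtx_eq_iff) (metis mod_add_left_eq)
  with c show "\<exists>c\<in>steps i. w = vtx (i + 1) (x + c)" by blast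
qed (auto simp: rises_def)

lemma vtx_rises: "rises w (vtx i x) \<longleftrightarrow> (\<exists>c\<in>steps (i - 1). w = vtx (i - 1) (x + c))"
proof
  assume "rises w (vtx i x)"
  then obtain y c where c: "c \<in> steps (i - 1)" "w = vtx (i - 1) y" "x mod 5 = (y + c) mod 5"
    by (auto simp: rises_def vtx_eq_iff)
  then have "y mod 5 = (x + - c) mod 5"
    by (simp add: mod_eq_dvd_iff algebra_simps dvd_diff_commute)
  then show "\<exists>c\<in>steps (i - 1). w = vtx (i - 1) (x + c)"
    using c by (intro bexI[of _ "- c"]) (auto simp: vtx_eq_iff steps_uminus)
next
  assume "\<exists>c\<in>steps (i - 1). w = vtx (i - 1) (x + c)"
  then obtain c where "c \<in> steps (i - 1)" "w = vtx (i - 1) (x + c)" by blast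
  then show "rises w (vtx i x)"
    by (auto simp: rises_vtx steps_uminus intro!: bexI[of _ "- c"])
qed

lemma adj_vtx: "adj (vtx i x) w \<longleftrightarrow>
    (\<exists>c\<in>steps i. w = vtx (i + 1) (x + c)) \<or> (\<exists>c\<in>steps (i - 1). w = vtx (i - 1) (x + c))"
  by (simp add: adj_def rises_vtx vtx_rises)

lemma mate_vtx: "mate (vtx i x) = vtx (if odd i then i + 1 else i - 1) x"
  by (simp add: mate_def vtx_eq_iff)

lemma vertices_decagon_graph [simp]: "vertices decagon_graph = UNIV"
  by (simp add: decagon_graph_def)

lemma edge_decagon_graph [simp]: "{u, v} \<in> edges decagon_graph \<longleftrightarrow> adj u v"
  using adj_sym by (auto simp: decagon_graph_def doubleton_eq_iff)

lemma adj_lev: "adj u v \<Longrightarrow> \<bar>lev u - lev v\<bar> = 1"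
  by (auto simp: adj_def rises_def)

lemma simple_decagon_graph: "simple_graph decagon_graph"
proof -
  have "u \<noteq> v" if "adj u v" for u v using adj_lev[OF that] by auto
  then show ?thesis by (simp add: simple_graph_def decagon_graph_def) blast
qed

subsection \<open>Automorphisms\<close>

definition automorphism :: "(nat \<Rightarrow> nat) \<Rightarrow> bool" where
  "automorphism f \<longleftrightarrow> bij f \<and> (\<forall>u v. adj u v \<longleftrightarrow> adj (f u) (f v))"

lemma graph_iso_decagon_graph: "graph_iso f decagon_graph decagon_graph \<longleftrightarrow> automorphism f"
  by (simp add: graph_iso_def automorphism_def)

text \<open>Edges preserved by both a map and its inverse are also reflected; by symmetry of
  \<open>adj\<close> it suffices to check upward edges.\<close>

lemma autoI:
  assumes "\<And>u v. rises u v \<Longrightarrow> adj (f u) (f v)" and "\<And>u v. rises u v \<Longrightarrow> adj (g u) (g v)"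
    and fg: "\<And>u. f (g u) = u" and gf: "\<And>u. g (f u) = u"
  shows "automorphism f"
proof -
  have f: "adj (f u) (f v)" if "adj u v" for u v
    using that assms(1) adj_sym by (metis adj_def)
  have g: "adj (g u) (g v)" if "adj u v" for u v
    using that assms(2) adj_sym by (metis adj_def)
  have "bij f" using fg gf by (metis bijI')
  then show ?thesis unfolding automorphism_def using f g gf by metis
qed

text \<open>That all automorphisms commute with \<open>mate\<close> is known only from
  \<open>auto_mate\<close> on, whose proof needs transitivity by automorphisms that do.\<close>

definition matching_orbit :: "nat \<Rightarrow> nat \<Rightarrow> bool" where
  "matching_orbit u v \<longleftrightarrow> (\<exists>f. automorphism f \<and> (\<forall>w. f (mate w) = mate (f w)) \<and> f u = v)"

lemma matching_orbit_trans: "matching_orbit u v \<Longrightarrow> matching_orbit v w \<Longrightarrow> matching_orbit u w"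
  unfolding matching_orbit_def
proof clarify
  fix f g assume "automorphism f" "\<forall>w. f (mate w) = mate (f w)" "automorphism g" "\<forall>w. g (mate w) = mate (g w)"
  then have "automorphism (g \<circ> f) \<and> (\<forall>w. (g \<circ> f) (mate w) = mate ((g \<circ> f) w)) \<and> (g \<circ> f) u = g (f u)"
    by (auto simp: automorphism_def bij_comp)
  then show "\<exists>h. automorphism h \<and> (\<forall>w. h (mate w) = mate (h w)) \<and> h u = g (f u)" by blast
qed

lemma auto_inverse:
  assumes "automorphism f"
  obtains g where "automorphism g" "\<And>w. f (g w) = w" "\<And>w. g (f w) = w"
proof -
  define g where "g = inv_into UNIV f"
  have "bij f" using assms by (simp add: automorphism_def)
  then have g: "f (g w) = w" "g (f w) = w" for w
    by (simp_all add: g_def bij_is_surj surj_f_inv_f bij_is_inj)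
  have "bij g" using \<open>bij f\<close> by (simp add: g_def bij_imp_bij_inv)
  then have "automorphism g" using assms unfolding automorphism_def by (metis g(1))
  then show ?thesis using that g by blast
qed

lemma matching_orbit_sym: "matching_orbit u v \<Longrightarrow> matching_orbit v u"
  unfolding matching_orbit_def
proof clarify
  fix f assume f: "automorphism f" "\<forall>w. f (mate w) = mate (f w)"
  obtain g where g: "automorphism g" "\<And>w. f (g w) = w" "\<And>w. g (f w) = w"
    using auto_inverse[OF f(1)] by blast
  then have "g (mate w) = mate (g w)" for w using f(2) by metis
  then show "\<exists>g. automorphism g \<and> (\<forall>w. g (mate w) = mate (g w)) \<and> g (f u) = u" using g by blast
qed

text \<open>Adjacency depends on residues only through their difference, so all levels can be
  rotated at once.\<close>

lemma matching_orbit_translate: "matching_orbit (vtx i x) (vtx i (x + y))"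
proof -
  define t where "t y n = vtx (lev n) (pos n + y)" for y n
  have t: "t y (vtx i x) = vtx i (x + y)" for i x y
    by (simp add: t_def vtx_eq_iff mod_add_left_eq)
  have ab: "adj (t y u) (t y v)" if "rises u v" for u v y
    using that by (force simp: rises_def adj_vtx t vtx_eq_iff add_ac)
  have inv: "t y (t (- y) u) = u" for u y by (cases u rule: vtx_cases) (simp add: t)
  have "automorphism (t y)"
    by (rule autoI[where g = "t (- y)"]) (use ab inv[of y] inv[of "- y"] in auto)
  moreover have "t y (mate w) = mate (t y w)" for w
    by (cases w rule: vtx_cases) (simp add: t mate_vtx)
  ultimately show ?thesis unfolding matching_orbit_def using t by blast
qed

text \<open>Modulo 5, multiplication by 2 exchanges the sets {1, -1} and {2, -2}, and 3 is the
  inverse of 2.\<close>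

lemma steps_shift: "c \<in> steps i \<Longrightarrow> \<exists>d\<in>steps (i + 2). d mod 5 = (2 * c) mod 5"
  "c \<in> steps i \<Longrightarrow> \<exists>d\<in>steps (i - 2). d mod 5 = (3 * c) mod 5"
proof -
  have "4 dvd i + 2 \<longleftrightarrow> \<not> 4 dvd i" "4 dvd i - 2 \<longleftrightarrow> \<not> 4 dvd i" if "even i"
    using that by presburger+
  then show "c \<in> steps i \<Longrightarrow> \<exists>d\<in>steps (i + 2). d mod 5 = (2 * c) mod 5"
    "c \<in> steps i \<Longrightarrow> \<exists>d\<in>steps (i - 2). d mod 5 = (3 * c) mod 5"
    by (auto simp: steps_def split: if_splits)
qed

text \<open>A shift by two levels exchanges the two kinds of decagon; doubling the residues
  compensates for this.\<close>

lemma matching_orbit_shift: "matching_orbit (vtx i x) (vtx (i + 2) (2 * x))"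
proof -
  define t where "t n = vtx (lev n + 2) (2 * pos n)" for n
  define s where "s n = vtx (lev n - 2) (3 * pos n)" for n
  have t: "t (vtx i x) = vtx (i + 2) (2 * x)" for i x
    by (simp add: t_def vtx_eq_iff mod_mult_right_eq)
  have s: "s (vtx i x) = vtx (i - 2) (3 * x)" for i x
    by (simp add: s_def vtx_eq_iff mod_mult_right_eq)
  have ts: "adj (t u) (t v)" "adj (s u) (s v)" if uv: "rises u v" for u v
  proof -
    obtain i x c where c: "c \<in> steps i" "u = vtx i x" "v = vtx (i + 1) (x + c)"
      using uv by (auto simp: rises_def)
    obtain d where "d \<in> steps (i + 2)" "d mod 5 = (2 * c) mod 5"
      using steps_shift(1)[OF c(1)] by blast
    moreover from this have "(2 * x + d) mod 5 = (2 * (x + c)) mod 5"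
      by (metis distrib_left mod_add_right_eq)
    ultimately show "adj (t u) (t v)" using c by (auto simp: t adj_vtx vtx_eq_iff intro!: bexI[of _ d])
    obtain d where "d \<in> steps (i - 2)" "d mod 5 = (3 * c) mod 5"
      using steps_shift(2)[OF c(1)] by blast
    moreover from this have "(3 * x + d) mod 5 = (3 * (x + c)) mod 5"
      by (metis distrib_left mod_add_right_eq)
    ultimately show "adj (s u) (s v)" using c by (auto simp: s adj_vtx vtx_eq_iff intro!: bexI[of _ d])
  qed
  have m: "(6 * x) mod 5 = x mod 5" for x :: int by presburger
  have "t (s u) = u" "s (t u) = u" for u
    by (cases u rule: vtx_cases, simp add: t s vtx_eq_iff m)+
  then have "automorphism t" by (intro autoI[of t s] ts)
  moreover have "t (mate w) = mate (t w)" for w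
    by (cases w rule: vtx_cases) (simp add: t mate_vtx)
  ultimately show ?thesis unfolding matching_orbit_def using t by blast
qed

text \<open>The centre lies halfway between levels 0 and 1, so decagons go to decagons and the
  parity of levels changes, which shifts by two levels cannot achieve.\<close>

definition reflect :: "nat \<Rightarrow> nat" where
  "reflect n = vtx (1 - lev n) (pos n)"

lemma reflect_vtx: "reflect (vtx i x) = vtx (1 - i) x"
  by (simp add: reflect_def vtx_eq_iff)

lemma reflect_reflect [simp]: "reflect (reflect u) = u"
  by (cases u rule: vtx_cases) (simp add: reflect_vtx)

lemma lev_reflect [simp]: "lev (reflect u) = 1 - lev u"
  by (simp add: reflect_def)

lemma steps_reflect: "steps (- i) = steps i"
  by (simp add: steps_def)

lemma auto_reflect: "automorphism reflect"
proof (rule autoI[where g = reflect])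
  show "adj (reflect u) (reflect v)" if uv: "rises u v" for u v
  proof -
    obtain i x c where c: "c \<in> steps i" "u = vtx i x" "v = vtx (i + 1) (x + c)"
      using uv by (auto simp: rises_def)
    then show ?thesis by (auto simp: reflect_vtx adj_vtx steps_reflect)
  qed
  then show "adj (reflect u) (reflect v)" if "rises u v" for u v using that by blast
qed simp_all

lemma matching_orbit_reflect: "matching_orbit (vtx i x) (vtx (1 - i) x)"
proof -
  have "reflect (mate w) = mate (reflect w)" for w
    by (cases w rule: vtx_cases) (simp add: reflect_vtx mate_vtx)
  then show ?thesis unfolding matching_orbit_def using auto_reflect reflect_vtx by blast
qed

text \<open>Shifts reach the even levels at residue 0, which doubling fixes; the reflection adds the
  odd levels and translations the other residues.\<close>

lemma matching_orbit_all: "matching_orbit u v"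
proof -
  have even: "matching_orbit (vtx 0 0) (vtx (2 * k) 0)" for k
  proof (induction k rule: int_induct[where k = 0])
    case base then show ?case using matching_orbit_translate[of 0 0 0] by simp
  next
    case (step1 k)
    then show ?case using matching_orbit_trans[OF _ matching_orbit_shift[of "2 * k" 0]]
      by (simp add: algebra_simps)
  next
    case (step2 k)
    have "matching_orbit (vtx (2 * k) 0) (vtx (2 * (k - 1)) 0)"
      using matching_orbit_sym[OF matching_orbit_shift[of "2 * (k - 1)" 0]] by (simp add: algebra_simps)
    then show ?case using step2 matching_orbit_trans by blast
  qed
  have "matching_orbit (vtx 0 0) (vtx i 0)" for i
  proof (cases "even i")
    case True then show ?thesis using even by (metis evenE)
  next
    case False
    then have "even (1 - i)" by simp
    then have "matching_orbit (vtx 0 0) (vtx (1 - i) 0)" using even by (metis evenE)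
    then show ?thesis using matching_orbit_trans[OF _ matching_orbit_reflect[of "1 - i" 0]] by simp
  qed
  then have "matching_orbit (vtx 0 0) (vtx i x)" for i x
    using matching_orbit_trans[OF _ matching_orbit_translate[of i 0 x]] by simp
  then have "matching_orbit (vtx 0 0) w" for w by (cases w rule: vtx_cases) simp
  then show ?thesis using matching_orbit_trans matching_orbit_sym by blast
qed

section \<open>Transitivity and degree\<close>

lemma vertex_transitive_decagon_graph: "vertex_transitive decagon_graph"
  unfolding vertex_transitive_def graph_iso_decagon_graph
  using matching_orbit_all[unfolded matching_orbit_def] by blast

lemma cubic_decagon_graph: "cubic_graph decagon_graph"
proof -
  have "card {e \<in> edges decagon_graph. v \<in> e} = 3" for v
  proof -
    obtain f where f: "automorphism f" "f (vtx 1 0) = v"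
      using matching_orbit_all[of "vtx 1 0" v] by (auto simp: matching_orbit_def)
    then have bij: "bij f" by (simp add: automorphism_def)
    have "{w. adj (vtx 1 0) w} = {vtx 2 0, vtx 0 1, vtx 0 (- 1)}"
      by (auto simp: adj_vtx steps_def)
    then have "card {w. adj (vtx 1 0) w} = 3"
      by (simp add: vtx_eq_iff)
    moreover have "{w. adj v w} = f ` {w. adj (vtx 1 0) w}"
      using f bij unfolding automorphism_def by (auto simp: image_iff) (metis bij_pointE)
    ultimately have "card {w. adj v w} = 3"
      using bij by (metis bij_is_inj card_image inj_on_subset subset_UNIV)
    moreover have "{e \<in> edges decagon_graph. v \<in> e} = (\<lambda>w. {v, w}) ` {w. adj v w}"
      by (auto simp: decagon_graph_def adj_sym)
    moreover have "inj_on (\<lambda>w. {v, w}) {w. adj v w}"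
      by (auto simp: inj_on_def doubleton_eq_iff)
    ultimately show ?thesis by (simp add: card_image)
  qed
  then show ?thesis by (simp add: cubic_graph_def)
qed

subsection \<open>Ends\<close>

text \<open>Climb from both vertices to a common level divisible by 4. Going up and down from there
  changes the residue by 2, which generates the residues modulo 5.\<close>

lemma linked_above_decagon_graph:
  assumes "k \<le> lev u" "k \<le> lev v"
  shows "linked {e \<in> edges decagon_graph. \<forall>w\<in>e. k \<le> lev w} u v"
proof -
  let ?E = "{e \<in> edges decagon_graph. \<forall>w\<in>e. k \<le> lev w}"
  have climb: "\<exists>y. linked ?E (vtx i x) (vtx (i + int n) y)" if "k \<le> i" for i x n
  proof (induction n)
    case 0 show ?case by (auto intro: exI[of _ x] linked_refl)
  next
    case (Suc n)
    then obtain y where y: "linked ?E (vtx i x) (vtx (i + int n) y)" by blast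
    obtain c where "c \<in> steps (i + int n)" using steps_nonempty by blast
    then have "{vtx (i + int n) y, vtx (i + int (Suc n)) (y + c)} \<in> ?E"
      using that by (auto simp: adj_vtx add_ac)
    then have "linked ?E (vtx i x) (vtx (i + int (Suc n)) (y + c))"
      by (rule linked_trans[OF y linked_edge])
    then show ?case by blast
  qed
  have two: "linked ?E (vtx i x) (vtx i (x + 2 * int n))" if "k \<le> i" "4 dvd i" for i x n
  proof (induction n)
    case 0 then show ?case by (simp add: linked_refl)
  next
    case (Suc n)
    let ?z = "x + 2 * int n"
    have "1 \<in> steps i" using that by (auto simp: steps_def)
    then have "{vtx i ?z, vtx (i + 1) (?z + 1)} \<in> ?E" "{vtx (i + 1) (?z + 1), vtx i (?z + 2)} \<in> ?E"
      using that by (auto simp: adj_vtx add.assoc intro!: bexI[of _ 1])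
    then have "linked ?E (vtx i ?z) (vtx i (?z + 2))"
      by (rule linked_trans[OF linked_edge linked_edge])
    moreover have "x + 2 * int (Suc n) = ?z + 2" by simp
    ultimately show ?case using linked_trans[OF Suc] by (simp only:)
  qed
  obtain i x j y where uv: "u = vtx i x" "v = vtx j y" by (metis vtx_lev_pos)
  define l where "l = 4 * (\<bar>i\<bar> + \<bar>j\<bar>)"
  have l: "i \<le> l" "j \<le> l" "4 dvd l" "k \<le> l" using assms uv by (auto simp: l_def)
  obtain x' where x': "linked ?E u (vtx l x')"
    using climb[of i x "nat (l - i)"] assms l uv by auto
  obtain y' where y': "linked ?E v (vtx l y')"
    using climb[of j y "nat (l - j)"] assms l uv by auto
  \<comment> \<open>Since 3 inverts 2 modulo 5, \<open>n\<close> moves of 2 lead from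
    \<open>x'\<close> to \<open>y'\<close>.\<close>
  define n where "n = nat ((3 * (y' - x')) mod 5)"
  have "vtx l y' = vtx l (x' + 2 * int n)"
  proof -
    have key: "x' + 2 * (3 * (y' - x')) = y' + 5 * (y' - x')" by simp
    have "(x' + 2 * ((3 * (y' - x')) mod 5)) mod 5 = (y' + 5 * (y' - x')) mod 5"
      by (metis (no_types, opaque_lifting) mod_mult_right_eq mod_add_right_eq key)
    also have "\<dots> = y' mod 5" by (rule mod_mult_self2)
    finally show ?thesis by (simp add: n_def vtx_eq_iff)
  qed
  then have "linked ?E (vtx l x') (vtx l y')" using two[OF l(4,3), of x' n] by simp
  then show ?thesis by (rule linked_trans[OF x' linked_trans[OF _ linked_sym[OF y']]])
qed

lemma finite_lev: "finite {v. lev v = i}"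
proof -
  have "{v. lev v = i} \<subseteq> vtx i ` {0..<5}"
  proof
    fix v assume "v \<in> {v. lev v = i}"
    then have "v = vtx i (pos v)" "pos v \<in> {0..<5}"
      using vtx_lev_pos[of v] by (simp_all add: pos_def)
    then show "v \<in> vtx i ` {0..<5}" by blast
  qed
  then show ?thesis by (rule finite_subset) simp
qed

lemma ascend_decagon_graph: "\<exists>w. adj v w \<and> lev w = lev v + 1"
proof -
  obtain i x where v: "v = vtx i x" by (rule vtx_cases)
  obtain c where "c \<in> steps i" using steps_nonempty by blast
  then show ?thesis unfolding v by (intro exI[of _ "vtx (i + 1) (x + c)"]) (auto simp: adj_vtx)
qed

lemma reflect_adj: "adj (reflect u) (reflect v) \<longleftrightarrow> adj u v"
  using auto_reflect by (simp add: automorphism_def)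

lemma two_ended_decagon_graph: "two_ended decagon_graph"
proof (rule two_ended_layered)
  show "layered_graph decagon_graph lev"
    by unfold_locales
      (simp_all add: simple_decagon_graph adj_lev finite_lev ascend_decagon_graph
        linked_above_decagon_graph)
  show "layered_graph decagon_graph (\<lambda>v. - lev v)"
  proof unfold_locales
    fix u v :: nat and k :: int
    show "\<exists>w. {v, w} \<in> edges decagon_graph \<and> - lev w = - lev v + 1"
    proof -
      obtain w where "adj (reflect v) w" "lev w = lev (reflect v) + 1"
        using ascend_decagon_graph by blast
      then show ?thesis using reflect_adj[of "reflect v" w]
        by (intro exI[of _ "reflect w"]) simp
    qed
    assume k: "k \<le> - lev u" "k \<le> - lev v"
    \<comment> \<open>The bound is \<open>k + 1\<close> because \<open>reflect\<close> sends level
      \<open>l\<close> to \<open>1 - l\<close>, whose negative is \<open>l - 1\<close>.\<close>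
    have "linked {e \<in> edges decagon_graph. \<forall>w\<in>e. k + 1 \<le> lev w} (reflect u) (reflect v)"
      using k by (intro linked_above_decagon_graph) simp_all
    then have "linked {e \<in> edges decagon_graph. \<forall>w\<in>e. k \<le> - lev w}
        (reflect (reflect u)) (reflect (reflect v))"
      by (rule linked_map) (auto simp: reflect_adj)
    then show "linked {e \<in> edges decagon_graph. \<forall>w\<in>e. k \<le> - lev w} u v" by simp
  next
    show "\<bar>- lev u - - lev v\<bar> = 1" if "{u, v} \<in> edges decagon_graph" for u v
      using adj_lev[of u v] that by simp
    have "{v. - lev v = i} = {v. lev v = - i}" for i by auto
    then show "finite {v \<in> vertices decagon_graph. - lev v = i}" for i by (simp add: finite_lev)
  qed (simp_all add: simple_decagon_graph)
qed

lemma connected_decagon_graph: "connected_graph decagon_graph"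
  unfolding connected_graph_def
proof clarify
  fix u v
  have "linked {e \<in> edges decagon_graph. \<forall>w\<in>e. min (lev u) (lev v) \<le> lev w} u v"
    by (rule linked_above_decagon_graph) simp_all
  then show "linked (edges decagon_graph) u v" by (rule linked_mono) auto
qed

subsection \<open>The matching is invariant\<close>

text \<open>
  A path of length 3 whose middle edge belongs to the matching lies in exactly one 8-cycle, whereas
  three consecutive edges of a 10-cycle lie in two.
\<close>

definition closed_by :: "nat \<Rightarrow> nat \<Rightarrow> nat \<Rightarrow> nat \<Rightarrow> nat \<times> nat \<times> nat \<times> nat \<Rightarrow> bool" where
  "closed_by a u v b = (\<lambda>(p, q, r, s).
     adj a p \<and> adj p q \<and> adj q r \<and> adj r s \<and> adj s b \<and>
     p \<noteq> u \<and> q \<noteq> a \<and> r \<noteq> p \<and> s \<noteq> q \<and> b \<noteq> r \<and> v \<noteq> s)"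

text \<open>The octagons are closed walks of length 8 without backtracking. Asking for two through
  one path makes this an automorphism-invariant test for edges outside the matching.\<close>

definition two_octagons :: "nat \<Rightarrow> nat \<Rightarrow> bool" where
  "two_octagons u v \<longleftrightarrow> (\<exists>a b P Q. adj a u \<and> adj v b \<and> a \<noteq> v \<and> b \<noteq> u \<and>
     closed_by a u v b P \<and> closed_by a u v b Q \<and> P \<noteq> Q)"

lemma two_octagons_auto:
  assumes "automorphism f" and "two_octagons u v"
  shows "two_octagons (f u) (f v)"
proof -
  have f: "adj (f x) (f y) \<longleftrightarrow> adj x y" "f x = f y \<longleftrightarrow> x = y" for x y
    using assms(1) by (auto simp: automorphism_def bij_is_inj inj_eq)
  obtain a b p q r s p' q' r' s' where "adj a u \<and> adj v b \<and> a \<noteq> v \<and> b \<noteq> u \<and>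
     closed_by a u v b (p, q, r, s) \<and> closed_by a u v b (p', q', r', s') \<and>
     (p, q, r, s) \<noteq> (p', q', r', s')"
    using assms(2) unfolding two_octagons_def by (metis prod_cases4)
  then show ?thesis unfolding two_octagons_def
    by (intro exI[of _ "f a"] exI[of _ "f b"] exI[of _ "(f p, f q, f r, f s)"]
        exI[of _ "(f p', f q', f r', f s')"]) (simp add: closed_by_def f)
qed

text \<open>Four edges of this decagon change the residue by 4 = 2 + 2, as do two edges of either
  neighbouring decagon. One octagon closes up below and one above; the second claim negates all
  residues.\<close>

lemma two_octagons_decagon: "two_octagons (vtx 1 0) (vtx 0 1)" "two_octagons (vtx 1 0) (vtx 0 (- 1))"
proof -
  show "two_octagons (vtx 1 0) (vtx 0 1)" unfolding two_octagons_def
    by (intro exI[of _ "vtx 0 4"] exI[of _ "vtx 1 2"]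
        exI[of _ "(vtx (- 1) 4, vtx (- 2) 1, vtx (- 1) 3, vtx 0 3)"]
        exI[of _ "(vtx 1 3, vtx 2 3, vtx 3 0, vtx 2 2)"])
      (simp add: closed_by_def adj_vtx steps_def vtx_eq_iff)
  show "two_octagons (vtx 1 0) (vtx 0 (- 1))" unfolding two_octagons_def
    by (intro exI[of _ "vtx 0 1"] exI[of _ "vtx 1 3"]
        exI[of _ "(vtx (- 1) 1, vtx (- 2) 4, vtx (- 1) 2, vtx 0 2)"]
        exI[of _ "(vtx 1 2, vtx 2 2, vtx 3 0, vtx 2 3)"])
      (simp add: closed_by_def adj_vtx steps_def vtx_eq_iff)
qed

text \<open>Without backtracking, \<open>p\<close> and \<open>s\<close> have two candidates each,
  and just one of the four combinations is joined by a path of length 3.\<close>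

lemma closed_by_matching:
  "closed_by (vtx 0 1) (vtx 1 0) (vtx 2 0) (vtx 3 2) P \<Longrightarrow>
     P = (vtx 1 2, vtx 0 3, vtx 1 4, vtx 2 4)"
  "closed_by (vtx 0 1) (vtx 1 0) (vtx 2 0) (vtx 3 (- 2)) P \<Longrightarrow>
     P = (vtx 1 2, vtx 2 2, vtx 3 4, vtx 2 1)"
  "closed_by (vtx 0 (- 1)) (vtx 1 0) (vtx 2 0) (vtx 3 2) P \<Longrightarrow>
     P = (vtx 1 3, vtx 2 3, vtx 3 1, vtx 2 4)"
  "closed_by (vtx 0 (- 1)) (vtx 1 0) (vtx 2 0) (vtx 3 (- 2)) P \<Longrightarrow>
     P = (vtx 1 3, vtx 0 2, vtx 1 1, vtx 2 1)"
proof -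
  obtain p q r s where P: "P = (p, q, r, s)" by (metis prod_cases4)
  show "P = (vtx 1 2, vtx 0 3, vtx 1 4, vtx 2 4)" if "closed_by (vtx 0 1) (vtx 1 0) (vtx 2 0) (vtx 3 2) P"
  proof -
    have "adj (vtx 0 1) p" "p \<noteq> vtx 1 0" "adj (vtx 3 2) s" "s \<noteq> vtx 2 0"
      and *: "adj p q" "adj q r" "adj r s" "q \<noteq> vtx 0 1" "r \<noteq> p" "s \<noteq> q" "r \<noteq> vtx 3 2"
      using that adj_sym by (auto simp: closed_by_def P)
    \<comment> \<open>At level 1 the neighbours of \<open>vtx 0 x\<close> with \<open>x\<close> = 1
      or -1 have residues 0 and \<open>2 * x\<close>, and 0 would backtrack. The same holds for
      \<open>s\<close> with 2 or -2.\<close>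
    then have "p = vtx 1 (2 * 1) \<or> p = vtx (- 1) 1" "s = vtx 2 (2 * 2) \<or> s = vtx 4 2"
      by (auto simp: adj_vtx steps_def vtx_eq_iff)
    then show ?thesis using *
      by (elim disjE) (auto simp: P adj_vtx steps_def vtx_eq_iff)
  qed
  show "P = (vtx 1 2, vtx 2 2, vtx 3 4, vtx 2 1)" if "closed_by (vtx 0 1) (vtx 1 0) (vtx 2 0) (vtx 3 (- 2)) P"
  proof -
    have "adj (vtx 0 1) p" "p \<noteq> vtx 1 0" "adj (vtx 3 (- 2)) s" "s \<noteq> vtx 2 0"
      and *: "adj p q" "adj q r" "adj r s" "q \<noteq> vtx 0 1" "r \<noteq> p" "s \<noteq> q" "r \<noteq> vtx 3 (- 2)"
      using that adj_sym by (auto simp: closed_by_def P)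
    then have "p = vtx 1 (2 * 1) \<or> p = vtx (- 1) 1" "s = vtx 2 (2 * (- 2)) \<or> s = vtx 4 (- 2)"
      by (auto simp: adj_vtx steps_def vtx_eq_iff)
    then show ?thesis using *
      by (elim disjE) (auto simp: P adj_vtx steps_def vtx_eq_iff)
  qed
  show "P = (vtx 1 3, vtx 2 3, vtx 3 1, vtx 2 4)" if "closed_by (vtx 0 (- 1)) (vtx 1 0) (vtx 2 0) (vtx 3 2) P"
  proof -
    have "adj (vtx 0 (- 1)) p" "p \<noteq> vtx 1 0" "adj (vtx 3 2) s" "s \<noteq> vtx 2 0"
      and *: "adj p q" "adj q r" "adj r s" "q \<noteq> vtx 0 (- 1)" "r \<noteq> p" "s \<noteq> q" "r \<noteq> vtx 3 2"
      using that adj_sym by (auto simp: closed_by_def P)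
    then have "p = vtx 1 (2 * (- 1)) \<or> p = vtx (- 1) (- 1)" "s = vtx 2 (2 * 2) \<or> s = vtx 4 2"
      by (auto simp: adj_vtx steps_def vtx_eq_iff)
    then show ?thesis using *
      by (elim disjE) (auto simp: P adj_vtx steps_def vtx_eq_iff)
  qed
  show "P = (vtx 1 3, vtx 0 2, vtx 1 1, vtx 2 1)" if "closed_by (vtx 0 (- 1)) (vtx 1 0) (vtx 2 0) (vtx 3 (- 2)) P"
  proof -
    have "adj (vtx 0 (- 1)) p" "p \<noteq> vtx 1 0" "adj (vtx 3 (- 2)) s" "s \<noteq> vtx 2 0"
      and *: "adj p q" "adj q r" "adj r s" "q \<noteq> vtx 0 (- 1)" "r \<noteq> p" "s \<noteq> q" "r \<noteq> vtx 3 (- 2)"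
      using that adj_sym by (auto simp: closed_by_def P)
    then have "p = vtx 1 (2 * (- 1)) \<or> p = vtx (- 1) (- 1)" "s = vtx 2 (2 * (- 2)) \<or> s = vtx 4 (- 2)"
      by (auto simp: adj_vtx steps_def vtx_eq_iff)
    then show ?thesis using *
      by (elim disjE) (auto simp: P adj_vtx steps_def vtx_eq_iff)
  qed
qed

lemma not_two_octagons_matching: "\<not> two_octagons (vtx 1 0) (vtx 2 0)"
proof
  assume "two_octagons (vtx 1 0) (vtx 2 0)"
  then obtain a b P Q where ab: "adj (vtx 1 0) a" "adj (vtx 2 0) b" "a \<noteq> vtx 2 0" "b \<noteq> vtx 1 0"
    and PQ: "closed_by a (vtx 1 0) (vtx 2 0) b P" "closed_by a (vtx 1 0) (vtx 2 0) b Q" "P \<noteq> Q"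
    unfolding two_octagons_def using adj_sym by metis
  have "a = vtx 0 1 \<or> a = vtx 0 (- 1)" "b = vtx 3 2 \<or> b = vtx 3 (- 2)"
    using ab by (auto simp: adj_vtx steps_def)
  then show False using PQ closed_by_matching by (elim disjE) metis+
qed

text \<open>An automorphism commuting with \<open>mate\<close> moves \<open>u\<close> to
  \<open>vtx 1 0\<close>, where all three edges have been tested.\<close>

lemma two_octagons_iff:
  assumes "adj u v"
  shows "two_octagons u v \<longleftrightarrow> v \<noteq> mate u"
proof -
  obtain f where f: "automorphism f" "\<forall>w. f (mate w) = mate (f w)" "f u = vtx 1 0"
    using matching_orbit_all[of u "vtx 1 0"] by (auto simp: matching_orbit_def)
  obtain g where g: "automorphism g" "g (vtx 1 0) = u" "g (f v) = v"
    using auto_inverse[OF f(1)] f(3) by metis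
  have "two_octagons u v \<longleftrightarrow> two_octagons (vtx 1 0) (f v)"
    using two_octagons_auto[OF f(1), of u v] two_octagons_auto[OF g(1), of "vtx 1 0" "f v"]
      f g by auto
  moreover have "adj (vtx 1 0) (f v)" using assms f by (metis automorphism_def)
  then have "f v = vtx 2 0 \<or> f v = vtx 0 1 \<or> f v = vtx 0 (- 1)"
    by (auto simp: adj_vtx steps_def)
  then have "two_octagons (vtx 1 0) (f v) \<longleftrightarrow> f v \<noteq> vtx 2 0"
    using two_octagons_decagon not_two_octagons_matching by metis
  moreover have "f (mate u) = vtx 2 0" using f by (simp add: mate_vtx)
  then have "f v = vtx 2 0 \<longleftrightarrow> v = mate u"
    using f(1) by (metis automorphism_def bij_is_inj inj_eq)
  ultimately show ?thesis by simp
qed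

lemma adj_mate: "adj u (mate u)"
  by (cases u rule: vtx_cases) (auto simp: mate_vtx adj_vtx steps_def)

text \<open>Otherwise the preimage of the edge from \<open>f u\<close> to its mate would pass the
  octagon test while the edge itself fails it.\<close>

lemma auto_mate:
  assumes "automorphism f"
  shows "f (mate u) = mate (f u)"
proof (rule ccontr)
  obtain w where w: "f w = mate (f u)" using assms by (metis automorphism_def bij_pointE)
  assume "f (mate u) \<noteq> mate (f u)"
  then have "w \<noteq> mate u" using w by blast
  moreover have "adj u w" using assms w adj_mate by (metis automorphism_def)
  ultimately have "two_octagons u w" by (simp add: two_octagons_iff)
  then have "two_octagons (f u) (f w)" by (rule two_octagons_auto[OF assms])
  then show False using w adj_mate by (simp add: two_octagons_iff)
qed

subsection \<open>No regular group of automorphisms\<close>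

text \<open>Distance two along a decagon: a 5-cycle on each level, with residue steps 2 or -2 on
  level 1 and 1 or -1 on level 2.\<close>

definition two_apart :: "nat \<Rightarrow> nat \<Rightarrow> bool" where
  "two_apart u v \<longleftrightarrow> u \<noteq> v \<and> (\<exists>w. adj u w \<and> adj w v \<and> w \<noteq> mate u \<and> w \<noteq> mate v)"

lemma two_apart_auto:
  assumes "automorphism f" and "two_apart u v"
  shows "two_apart (f u) (f v)"
proof -
  have f: "adj (f x) (f y) \<longleftrightarrow> adj x y" "f x = f y \<longleftrightarrow> x = y" for x y
    using assms(1) by (auto simp: automorphism_def bij_is_inj inj_eq)
  show ?thesis using assms(2) unfolding two_apart_def auto_mate[OF assms(1), symmetric]
    by (metis f)
qed

lemma two_apart_1: "two_apart (vtx 1 0) (vtx 1 2)" "two_apart (vtx 1 2) (vtx 1 4)"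
proof -
  show "two_apart (vtx 1 0) (vtx 1 2)" unfolding two_apart_def
    by (intro conjI exI[of _ "vtx 0 1"]) (auto simp: adj_vtx steps_def mate_vtx vtx_eq_iff)
  show "two_apart (vtx 1 2) (vtx 1 4)" unfolding two_apart_def
    by (intro conjI exI[of _ "vtx 0 3"]) (auto simp: adj_vtx steps_def mate_vtx vtx_eq_iff)
qed

lemma two_apart_2:
  assumes "two_apart (vtx 2 x) w"
  shows "w = vtx 2 (x + 1) \<or> w = vtx 2 (x - 1)"
proof -
  \<comment> \<open>Two steps of 2 in the same direction add up to 4, which is -1 modulo 5.\<close>
  have m: "(4 + x) mod 5 = (x - 1) mod 5" "(x - 4) mod 5 = (x + 1) mod 5" by presburger+
  obtain z where z: "adj (vtx 2 x) z" "adj z w" "z \<noteq> vtx 1 x" "z \<noteq> mate w" "w \<noteq> vtx 2 x"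
    using assms by (auto simp: two_apart_def mate_vtx)
  have "z = vtx 3 (x + 2) \<or> z = vtx 3 (x - 2)"
    using z(1,3) by (auto simp: adj_vtx steps_def)
  then show ?thesis
    using z(2,4,5) by (auto simp: adj_vtx steps_def mate_vtx vtx_eq_iff m)
qed

lemma not_cayley_decagon_graph: "\<not> is_cayley decagon_graph"
proof
  assume "is_cayley decagon_graph"
  then obtain r where "graph_iso r decagon_graph decagon_graph" and r10: "r (vtx 1 0) = vtx 2 0"
    and inv: "\<And>w. r (r (vtx 1 0)) = vtx 1 0 \<Longrightarrow> r (r w) = w"
    by (rule cayley_regular_automorphism[of _ "vtx 1 0" "vtx 2 0"]) auto
  then have r: "automorphism r" by (simp add: graph_iso_decagon_graph)
  have m: "mate (vtx 1 x) = vtx 2 x" "mate (vtx 2 x) = vtx 1 x" for x by (simp_all add: mate_vtx)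
  \<comment> \<open>Commuting with \<open>mate\<close>, \<open>r\<close> swaps the matched pair, so
    its square fixes a vertex and hence all.\<close>
  have "r (vtx 2 0) = vtx 1 0" using auto_mate[OF r, of "vtx 1 0"] r10 by (simp add: m)
  then have rr: "r (r w) = w" for w using inv r10 by simp
  \<comment> \<open>\<open>r\<close> turns the cyclic order of level 1 with step 2 into that of level 2 with step 1, while
    \<open>r\<close> being an involution makes the induced permutation of the residues an involution.\<close>
  have a2: "two_apart (vtx 2 0) (r (vtx 1 2))" using two_apart_auto[OF r two_apart_1(1)] r10 by simp
  have a4: "two_apart (r (vtx 1 2)) (r (vtx 1 4))" by (rule two_apart_auto[OF r two_apart_1(2)])
  from two_apart_2[OF a2] show False
  proof
    assume r12: "r (vtx 1 2) = vtx 2 (0 + 1)"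
    have "r (vtx 2 1) = vtx 1 2" using rr[of "vtx 1 2"] r12 by simp
    \<comment> \<open>Now 2 goes to 1 and 1 to 2, so the image of 4, adjacent to 1 in the pentagon,
      would be 2 or 0. Both are already taken, by 1 and 0.\<close>
    then have r11: "r (vtx 1 1) = vtx 2 2" using auto_mate[OF r, of "vtx 2 1"] by (simp add: m)
    have "r (vtx 1 4) = vtx 2 2 \<or> r (vtx 1 4) = vtx 2 0"
      using two_apart_2[of 1 "r (vtx 1 4)"] a4 r12 by simp
    then have "vtx 1 4 = vtx 1 1 \<or> vtx 1 4 = vtx 1 0" using rr r11 r10 by metis
    then show False by (simp add: vtx_eq_iff)
  next
    assume r12: "r (vtx 1 2) = vtx 2 (0 - 1)"
    then have r12': "r (vtx 1 2) = vtx 2 4" by (simp add: vtx_eq_iff)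
    then have "r (vtx 2 4) = vtx 1 2" using rr[of "vtx 1 2"] by simp
    \<comment> \<open>Here 2 and 4 are exchanged, but their images would have to differ by 1 or
      -1.\<close>
    then have "r (vtx 1 4) = vtx 2 2" using auto_mate[OF r, of "vtx 2 4"] by (simp add: m)
    then show False using two_apart_2[of 4 "r (vtx 1 4)"] a4 r12' by (simp add: vtx_eq_iff)
  qed
qed

theorem theorem1p4:
  shows "\<exists>G :: nat ugraph. simple_graph G \<and> connected_graph G \<and> cubic_graph G \<and>
           two_ended G \<and> vertex_transitive G \<and> \<not> is_cayley G"
  using simple_decagon_graph connected_decagon_graph cubic_decagon_graph two_ended_decagon_graph
    vertex_transitive_decagon_graph not_cayley_decagon_graph by blast

end
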